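(* Let $a,b,c,d$ be real numbers with $a\neq 0$ and $c\neq 0$, and let $x_0,x_1,x_2,y_0,y_1,y_2$ be real numbers with $x_0y_1\neq0$, $x_1y_2\neq0$, $y_0x_1\neq0$, $y_1x_2\neq0$. Put $$S_0=\frac1{x_0y_1},\quad S_1=\frac1{x_1y_2},\quad T_0=\frac1{y_0x_1},\quad T_1=\frac1{y_1x_2},$$ and, for every integer $n\ge 0$ and $j\in\{0,1\}$, $$S_{4n+j}=a^nc^nS_j+d\sum_{i=0}^{n-1}(ac)^i+bc\sum_{i=0}^{n-1}(ac)^i,\qquad T_{4n+j}=a^nc^nT_j+b\sum_{i=0}^{n-1}(ac)^i+ad\sum_{i=0}^{n-1}(ac)^i,$$ $$S_{4n+2+j}=a^nc^{n+1}T_j+d\sum_{i=0}^{n}(ac)^i+bc\sum_{i=0}^{n-1}(ac)^i,\qquad T_{4n+2+j}=a^{n+1}c^nS_j+b\sum_{i=0}^{n}(ac)^i+ad\sum_{i=0}^{n-1}(ac)^i.$$ Assume that $S_k\neq0$ and $T_k\neq 0$ for all $k\ge0$. Then the solution $(x_n,y_n)_{n\ge0}$, with the given initial values $x_0,x_1,x_2,y_0,y_1,y_2$, of the system of difference equations $$x_{n+3}=\frac{x_ny_{n+1}}{y_{n+2}(a+bx_ny_{n+1})},\qquad y_{n+3}=\frac{y_nx_{n+1}}{x_{n+2}(c+dy_nx_{n+1})}\qquad(n\ge0)$$ is well defined (no denominator vanishes) and is given, for all $n\ge0$, by $$x_{2n}=x_0\prod_{r=0}^{n-1}\frac{S_{2r}}{T_{2r+1}},\qquad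 y_{2n}=y_0\prod_{r=0}^{n-1}\frac{T_{2r}}{S_{2r+1}},$$ $$x_{2n+1}=\frac{\prod_{r=0}^{n-1}S_{2r+1}}{y_0\prod_{r=0}^{n}T_{2r}},\qquad y_{2n+1}=\frac{\prod_{r=0}^{n-1}T_{2r+1}}{x_0\prod_{r=0}^{n}S_{2r}}.$$
   Context: Empty sums equal $0$ and empty products equal $1$. *)

theory Defs
  imports Complex_Main
begin

text \<open>Division in HOL is total (a quotient by 0 is 0). The first two conjuncts require every
  denominator to be nonzero, so that the recurrences hold as genuine quotients.\<close>

definition solves_system ::
  "real \<Rightarrow> real \<Rightarrow> real \<Rightarrow> real \<Rightarrow> (nat \<Rightarrow> real) \<Rightarrow> (nat \<Rightarrow> real) \<Rightarrow> bool" where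
  "solves_system a b c d x y \<longleftrightarrow> (\<forall>n.
     y (n + 2) * (a + b * x n * y (n + 1)) \<noteq> 0 \<and>
     x (n + 2) * (c + d * y n * x (n + 1)) \<noteq> 0 \<and>
     x (n + 3) = x n * y (n + 1) / (y (n + 2) * (a + b * x n * y (n + 1))) \<and>
     y (n + 3) = y n * x (n + 1) / (x (n + 2) * (c + d * y n * x (n + 1))))"

definition has_initial_values ::
  "real \<Rightarrow> real \<Rightarrow> real \<Rightarrow> (nat \<Rightarrow> real) \<Rightarrow> bool" where
  "has_initial_values u0 u1 u2 u \<longleftrightarrow> u 0 = u0 \<and> u 1 = u1 \<and> u 2 = u2"

end

(*
  In the quantities S n = 1 / (x n * y (n + 1)) and T n = 1 / (y n * x (n + 1)) the system becomes
  linear: S (n + 2) = c * T n + d and T (n + 2) = a * S n + b, which the given closed forms solve.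
  The unknowns are recovered from S and T by x (n + 2) / x n = S n / T (n + 1) and
  y (n + 2) / y n = T n / S (n + 1).
*)
theory Submission
  imports Defs
begin

text \<open>Justifies speaking of "the" solution. The system has order three: the values at
  \<open>m + 3\<close> are functions of those at \<open>m\<close>, \<open>m + 1\<close>,
  \<open>m + 2\<close>, so strong induction with three base cases suffices.\<close>

lemma solves_system_unique:
  assumes sol: "solves_system a b c d x y" "solves_system a b c d x' y'"
    and init: "has_initial_values x0 x1 x2 x" "has_initial_values y0 y1 y2 y"
      "has_initial_values x0 x1 x2 x'" "has_initial_values y0 y1 y2 y'"
  shows "x' = x" and "y' = y"
proof -
  have "x' n = x n \<and> y' n = y n" for n
  proof (induction n rule: less_induct)
    case (less n)
    consider "n = 0" | "n = 1" | "n = 2" | m where "n = m + 3"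
      by (metis One_nat_def Suc_1 add.commute le_add_diff_inverse less_2_cases not_less_eq_eq
          numeral_3_eq_3 le_antisym not_le)
    then show ?case
    proof cases
      case (4 m)
      then have "x' k = x k" "y' k = y k" if "k \<in> {m, m + 1, m + 2}" for k
        using less.IH that by auto
      then show ?thesis
        using sol 4 unfolding solves_system_def by simp
    qed (use init in \<open>auto simp: has_initial_values_def\<close>)
  qed
  then show "x' = x" and "y' = y"
    by auto
qed

text \<open>The factor \<open>a + b * x n * y (n + 1)\<close> equals
  \<open>a + b / S n = T (n + 2) / S n\<close>. Hence it cannot vanish, and the equation for
  \<open>x (n + 3)\<close> collapses to \<open>y (n + 2) * x (n + 3) = 1 / T (n + 2)\<close>, which
  is the assumed product at index \<open>n + 2\<close>.\<close>

lemma solves_system_if_linear: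
  fixes S T x y :: "nat \<Rightarrow> real"
  assumes lin: "\<And>n. S (n + 2) = c * T n + d" "\<And>n. T (n + 2) = a * S n + b"
    and nz: "\<And>n. S n \<noteq> 0" "\<And>n. T n \<noteq> 0"
    and inv: "\<And>n. x n * y (n + 1) = 1 / S n" "\<And>n. y n * x (n + 1) = 1 / T n"
  shows "solves_system a b c d x y"
proof -
  \<comment> \<open>Stated for generic sequences because both equations are instances:
    \<open>(U, V, u, v)\<close> is \<open>(S, T, x, y)\<close> for the first and
    \<open>(T, S, y, x)\<close> for the second.\<close>
  have step: "v (n + 2) * (p + q * u n * v (n + 1)) \<noteq> 0 \<and>
      u (n + 3) = u n * v (n + 1) / (v (n + 2) * (p + q * u n * v (n + 1)))"
    if "V (n + 2) = p * U n + q" "U n \<noteq> 0" "V (n + 2) \<noteq> 0"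
      "u n * v (n + 1) = 1 / U n" "v (n + 2) * u (n + 3) = 1 / V (n + 2)"
    for u v U V :: "nat \<Rightarrow> real" and p q n
  proof -
    have den: "p + q * u n * v (n + 1) = V (n + 2) / U n"
      using that by (simp add: mult.assoc field_simps)
    have "v (n + 2) \<noteq> 0"
      using that by auto
    moreover have "u (n + 3) = 1 / (v (n + 2) * V (n + 2))"
      using that(3,5) \<open>v (n + 2) \<noteq> 0\<close> by (metis divide_divide_eq_left mult.commute nonzero_mult_div_cancel_left)
    ultimately show ?thesis
      unfolding den using that by simp
  qed
  have shift: "x (n + 2) * y (n + 3) = 1 / S (n + 2)" "y (n + 2) * x (n + 3) = 1 / T (n + 2)" for n
    using inv[of "n + 2"] by (simp_all add: numeral_3_eq_3)
  show ?thesis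
    unfolding solves_system_def
    using step[of T _ a S b x y] step[of S _ c T d y x] lin nz inv shift by blast
qed

text \<open>The two products feed each other: passing from \<open>n\<close> to \<open>n + 1\<close>
  multiplies \<open>y n * x (n + 1) = 1 / T n\<close> by \<open>T n / S (n + 1)\<close>, which gives
  \<open>1 / S (n + 1)\<close>, and symmetrically. So they are proved in one induction.\<close>

lemma reciprocal_products:
  fixes S T x y :: "nat \<Rightarrow> real"
  assumes nz: "\<And>n. S n \<noteq> 0" "\<And>n. T n \<noteq> 0"
    and rec: "\<And>n. x (n + 2) = x n * S n / T (n + 1)" "\<And>n. y (n + 2) = y n * T n / S (n + 1)"
    and init: "x 0 * y 1 = 1 / S 0" "y 0 * x 1 = 1 / T 0"
  shows "x n * y (n + 1) = 1 / S n" and "y n * x (n + 1) = 1 / T n"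
proof -
  have "x n * y (n + 1) = 1 / S n \<and> y n * x (n + 1) = 1 / T n"
  proof (induction n)
    case (Suc n)
    have "x (n + 1) * y (n + 2) = (y n * x (n + 1)) * T n / S (n + 1)"
      "y (n + 1) * x (n + 2) = (x n * y (n + 1)) * S n / T (n + 1)"
      by (simp_all only: rec) simp_all
    then show ?case
      using Suc.IH nz by simp
  qed (use init in simp)
  then show "x n * y (n + 1) = 1 / S n" and "y n * x (n + 1) = 1 / T n"
    by auto
qed

text \<open>The four closed forms are invariant under swapping \<open>U\<close> with
  \<open>V\<close>, \<open>p\<close> with \<open>q\<close> and \<open>u\<close> with
  \<open>v\<close>, so this single recurrence serves for both \<open>S\<close> and
  \<open>T\<close>.\<close>

lemma linear_recurrence_of_closed_form:
  fixes p q u v :: real and U V :: "nat \<Rightarrow> real"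
  assumes U4: "\<And>n j. j \<in> {0, 1} \<Longrightarrow>
      U (4 * n + j) = (p * q) ^ n * U j + (u + v * q) * (\<Sum>i<n. (p * q) ^ i)"
    and V4: "\<And>n j. j \<in> {0, 1} \<Longrightarrow>
      V (4 * n + j) = (p * q) ^ n * V j + (v + u * p) * (\<Sum>i<n. (p * q) ^ i)"
    and U2: "\<And>n j. j \<in> {0, 1} \<Longrightarrow>
      U (4 * n + 2 + j) = (p * q) ^ n * q * V j + u * (\<Sum>i\<le>n. (p * q) ^ i) + v * q * (\<Sum>i<n. (p * q) ^ i)"
    and V2: "\<And>n j. j \<in> {0, 1} \<Longrightarrow>
      V (4 * n + 2 + j) = (p * q) ^ n * p * U j + v * (\<Sum>i\<le>n. (p * q) ^ i) + u * p * (\<Sum>i<n. (p * q) ^ i)"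
  shows "U (k + 2) = q * V k + u"
proof -
  \<comment> \<open>With \<open>G\<close> the sum over \<open>i < n\<close>, this puts both sides of
    the claim in terms of \<open>G\<close>, leaving a polynomial identity.\<close>
  have sum_Suc: "(\<Sum>i\<le>n. (p * q) ^ i) = 1 + p * q * (\<Sum>i<n. (p * q) ^ i)" for n
    by (simp add: sum.atMost_shift sum_distrib_left)
  define n where "n = k div 4"
  have "k mod 4 \<in> {0, 1, 2, 3}"
    by auto
  then consider j where "j \<in> {0, 1}" "k = 4 * n + j" | j where "j \<in> {0, 1}" "k = 4 * n + 2 + j"
    using mult_div_mod_eq[of 4 k] unfolding n_def by fastforce
  then show ?thesis
  proof cases
    case (1 j)
    have "U (k + 2) = U (4 * n + 2 + j)"
      by (simp add: 1(2) add.commute add.left_commute)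
    then show ?thesis
      unfolding U2[OF 1(1)] 1(2) V4[OF 1(1)] sum_Suc by (simp add: algebra_simps)
  next
    case (2 j)
    \<comment> \<open>Here adding 2 crosses into the next block of four, so the first family applies
      with \<open>Suc n\<close>; its sum over \<open>i < Suc n\<close> is the sum over
      \<open>i \<le> n\<close>.\<close>
    have "k + 2 = 4 * Suc n + j"
      using 2(2) by simp
    then have "U (k + 2) = U (4 * Suc n + j)"
      by (simp only:)
    then show ?thesis
      unfolding U4[OF 2(1)] 2(2) V2[OF 2(1)] lessThan_Suc_atMost sum_Suc
      by (simp add: algebra_simps)
  qed
qed

theorem mainTheorem2:
  fixes a b c d x0 x1 x2 y0 y1 y2 :: real
    and S T :: "nat \<Rightarrow> real"
  assumes "a \<noteq> 0" and "c \<noteq> 0"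
    and "x0 * y1 \<noteq> 0" and "x1 * y2 \<noteq> 0" and "y0 * x1 \<noteq> 0" and "y1 * x2 \<noteq> 0"
    and "S 0 = 1 / (x0 * y1)" and "S 1 = 1 / (x1 * y2)"
    and "T 0 = 1 / (y0 * x1)" and "T 1 = 1 / (y1 * x2)"
    and "\<And>n j. j \<in> {0, 1} \<Longrightarrow>
      S (4 * n + j) = a ^ n * c ^ n * S j + d * (\<Sum>i<n. (a * c) ^ i) + b * c * (\<Sum>i<n. (a * c) ^ i)"
    and "\<And>n j. j \<in> {0, 1} \<Longrightarrow>
      T (4 * n + j) = a ^ n * c ^ n * T j + b * (\<Sum>i<n. (a * c) ^ i) + a * d * (\<Sum>i<n. (a * c) ^ i)"
    and "\<And>n j. j \<in> {0, 1} \<Longrightarrow>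
      S (4 * n + 2 + j) = a ^ n * c ^ (n + 1) * T j + d * (\<Sum>i\<le>n. (a * c) ^ i) + b * c * (\<Sum>i<n. (a * c) ^ i)"
    and "\<And>n j. j \<in> {0, 1} \<Longrightarrow>
      T (4 * n + 2 + j) = a ^ (n + 1) * c ^ n * S j + b * (\<Sum>i\<le>n. (a * c) ^ i) + a * d * (\<Sum>i<n. (a * c) ^ i)"
    and "\<And>k. S k \<noteq> 0" and "\<And>k. T k \<noteq> 0"
  shows "\<exists>x y.
      has_initial_values x0 x1 x2 x \<and> has_initial_values y0 y1 y2 y \<and> solves_system a b c d x y \<and>
      (\<forall>x' y'. has_initial_values x0 x1 x2 x' \<and> has_initial_values y0 y1 y2 y' \<and>
         solves_system a b c d x' y' \<longrightarrow> x' = x \<and> y' = y) \<and>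
      (\<forall>n. x (2 * n) = x0 * (\<Prod>r<n. S (2 * r) / T (2 * r + 1)) \<and>
           y (2 * n) = y0 * (\<Prod>r<n. T (2 * r) / S (2 * r + 1)) \<and>
           x (2 * n + 1) = (\<Prod>r<n. S (2 * r + 1)) / (y0 * (\<Prod>r\<le>n. T (2 * r))) \<and>
           y (2 * n + 1) = (\<Prod>r<n. T (2 * r + 1)) / (x0 * (\<Prod>r\<le>n. S (2 * r))))"
proof -
  note nz = assms(15,16)
  \<comment> \<open>Only \<open>p\<close> and \<open>v\<close> are absent from the conclusion of the
    lemma; unification with the goal fixes the other parameters.\<close>
  have S_rec: "S (k + 2) = c * T k + d" for k
    by (rule linear_recurrence_of_closed_form[where p = a and v = b];
        subst assms(11-14); simp add: power_mult_distrib algebra_simps)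
  have T_rec: "T (k + 2) = a * S k + b" for k
    by (rule linear_recurrence_of_closed_form[where p = c and v = d];
        subst assms(11-14); simp add: power_mult_distrib algebra_simps)

  define x where "x n = (if even n then x0 * (\<Prod>r<n div 2. S (2 * r) / T (2 * r + 1))
    else (\<Prod>r<n div 2. S (2 * r + 1)) / (y0 * (\<Prod>r\<le>n div 2. T (2 * r))))" for n
  define y where "y n = (if even n then y0 * (\<Prod>r<n div 2. T (2 * r) / S (2 * r + 1))
    else (\<Prod>r<n div 2. T (2 * r + 1)) / (x0 * (\<Prod>r\<le>n div 2. S (2 * r))))" for n

  \<comment> \<open>Each parity gains one factor. For \<open>n = 2 * m + 1\<close> the product over
    \<open>r \<le> m\<close> gains \<open>T (2 * (m + 1))\<close>, which is
    \<open>T (n + 1)\<close>, so one formula covers both cases.\<close>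
  have x_rec: "x (n + 2) = x n * S n / T (n + 1)" for n
    by (cases "even n"; elim evenE oddE) (simp_all add: x_def ac_simps)
  have y_rec: "y (n + 2) = y n * T n / S (n + 1)" for n
    by (cases "even n"; elim evenE oddE) (simp_all add: y_def ac_simps)

  have init: "x 0 = x0" "x 1 = x1" "y 0 = y0" "y 1 = y1"
    using assms(3-10) by (simp_all add: x_def y_def)
  \<comment> \<open>The values of \<open>T 1\<close> and \<open>S 1\<close> enter here:
    \<open>x0 * S 0 / T 1 = (1 / y1) * (y1 * x2)\<close>, and likewise for
    \<open>y2\<close>.\<close>
  moreover have "x 2 = x2" "y 2 = y2"
    using x_rec[of 0] y_rec[of 0] assms(3-10) init by (simp_all add: numeral_2_eq_2)
  ultimately have iv: "has_initial_values x0 x1 x2 x" "has_initial_values y0 y1 y2 y"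
    by (simp_all add: has_initial_values_def)

  have "x 0 * y 1 = 1 / S 0" "y 0 * x 1 = 1 / T 0"
    by (simp_all only: init assms(7,9) div_by_1 divide_divide_eq_right mult_1)
  note prods = reciprocal_products[OF nz x_rec y_rec this]
  have sol: "solves_system a b c d x y"
    by (rule solves_system_if_linear[OF S_rec T_rec nz prods])

  show ?thesis
  proof (intro exI conjI allI impI)
    fix x' y'
    assume "has_initial_values x0 x1 x2 x' \<and> has_initial_values y0 y1 y2 y' \<and>
      solves_system a b c d x' y'"
    then show "x' = x" "y' = y"
      using solves_system_unique[OF sol _ iv] by blast+
  qed (use iv sol in \<open>simp_all add: x_def y_def\<close>)
qed

end
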